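(* Let $G=(N,E)$ be a finite directed graph and let $(i,\xi,u)\in\mathbb R^E_{\ge0}\times\mathbb R^E_{\ge0}\times\mathbb R^N$ be such that $\min\{i,\xi-Du\}=0$ in $E$. Then for each path $\omega\subseteq\{i>0\}$ we have that $\omega\in\operatorname{Geod}(G,\xi)$ and $$d_\xi(\omega^-,\omega^+)=L_\xi(\omega)=u(\omega^+)-u(\omega^-).$$
   Context: A directed graph is $G=(N,E)$ with $N$ finite and $E\subseteq N\times N$; for $e=(x,y)$ write $e^-=x$, $e^+=y$. $Du(e)=u(e^+)-u(e^-)$; the minimum is coordinatewise; $\{i>0\}=\{e\in E:i(e)>0\}$. A path is a finite list of nodes $\omega=(x_0,\dots,x_\ell)$, $\ell\ge0$, with $(x_{k-1},x_k)\in E$; $\omega^-=x_0$, $\omega^+=x_\ell$; $\omega\subseteq A$ (for $A\subseteq E$) means all edges of $\omega$ lie in $A$. $L_\xi(\omega)=\sum_{e\in\omega}\xi(e)$ (edges counted with multiplicity), $d_\xi(x,y)=\min\{L_\xi(\omega):\omega^-=x,\omega^+=y\}$ ($+\infty$ if there is no such path), and $\operatorname{Geod}(G,\xi)$ is the set of paths with $L_\xi(\omega)=d_\xi(\omega^-,\omega^+)$. *)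

theory Defs
  imports "Graph_Theory.Graph_Theory"
begin

text \<open>A finite directed graph \<open>G = (N, E)\<close> with \<open>E \<subseteq> N \<times> N\<close> is a
  \<^locale>\<open>pair_fin_digraph\<close> (loops are allowed), with \<open>N = pverts G\<close> and \<open>E = parcs G\<close>.
  A path is a nonempty list of nodes \<open>\<omega>\<close> with \<open>vwalk \<omega> G\<close>; nodes and edges may be repeated,
  and \<open>\<omega>\<^sup>- = hd \<omega>\<close>, \<open>\<omega>\<^sup>+ = last \<omega>\<close>.\<close>

definition grad :: "('a \<Rightarrow> real) \<Rightarrow> 'a \<times> 'a \<Rightarrow> real" where
  "grad u e = u (snd e) - u (fst e)"

definition path_len :: "('a \<times> 'a \<Rightarrow> real) \<Rightarrow> 'a list \<Rightarrow> real" where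
  "path_len \<xi> \<omega> = (\<Sum>e\<leftarrow>vwalk_arcs \<omega>. \<xi> e)"

definition paths_between :: "'a pair_pre_digraph \<Rightarrow> 'a \<Rightarrow> 'a \<Rightarrow> 'a list set" where
  "paths_between G x y = {\<omega>. vwalk \<omega> (with_proj G) \<and> hd \<omega> = x \<and> last \<omega> = y}"

text \<open>The infimum over the empty set is \<open>\<infinity>\<close>. Otherwise, for \<open>\<xi> \<ge> 0\<close>, the infimum is
  attained, so it is a minimum; see \<open>path_dist_attained\<close> below.\<close>

definition path_dist :: "'a pair_pre_digraph \<Rightarrow> ('a \<times> 'a \<Rightarrow> real) \<Rightarrow> 'a \<Rightarrow> 'a \<Rightarrow> ereal" where
  "path_dist G \<xi> x y = (INF \<omega>\<in>paths_between G x y. ereal (path_len \<xi> \<omega>))"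

definition Geod :: "'a pair_pre_digraph \<Rightarrow> ('a \<times> 'a \<Rightarrow> real) \<Rightarrow> 'a list set" where
  "Geod G \<xi> = {\<omega>. vwalk \<omega> (with_proj G) \<and>
     ereal (path_len \<xi> \<omega>) = path_dist G \<xi> (hd \<omega>) (last \<omega>)}"

lemma pawalk_verts_vwalk_arcs:
  "\<omega> \<noteq> [] \<Longrightarrow> pawalk_verts (hd \<omega>) (vwalk_arcs \<omega>) = \<omega>"
  by (induction \<omega> rule: vwalk_arcs.induct) auto

lemma pcas_vwalk_arcs:
  "\<omega> \<noteq> [] \<Longrightarrow> pcas (hd \<omega>) (vwalk_arcs \<omega>) (last \<omega>)"
  by (induction \<omega> rule: vwalk_arcs.induct) auto

lemma pawalk_verts_ne: "pawalk_verts x p \<noteq> []" "hd (pawalk_verts x p) = x" if "pcas x p y"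
  using that by (cases p; auto)+

lemma vwalk_arcs_pawalk_verts:
  "pcas x p y \<Longrightarrow> vwalk_arcs (pawalk_verts x p) = p \<and> last (pawalk_verts x p) = y"
  by (induction p arbitrary: x) (auto simp: pawalk_verts_ne)

context pair_fin_digraph
begin

lemma vwalk_arcs_image_paths_between:
  "vwalk_arcs ` paths_between G x y = {p. awalk x p y}"
proof (intro set_eqI iffI)
  fix p assume "p \<in> vwalk_arcs ` paths_between G x y"
  then obtain \<omega> where w: "p = vwalk_arcs \<omega>" "vwalk \<omega> (with_proj G)" "hd \<omega> = x" "last \<omega> = y"
    by (auto simp: paths_between_def)
  then have "\<omega> \<noteq> []" "set \<omega> \<subseteq> pverts G" "set (vwalk_arcs \<omega>) \<subseteq> parcs G"
    by (auto simp: vwalk_def)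
  moreover have "x \<in> pverts G" using calculation w(3) by (metis hd_in_set subsetD)
  ultimately show "p \<in> {p. awalk x p y}"
    using w pcas_vwalk_arcs[of \<omega>] by (auto simp: awalk_def)
next
  fix p assume "p \<in> {p. awalk x p y}"
  then have a: "awalk x p y" by simp
  then have c: "pcas x p y" by (auto simp: awalk_def)
  have "vwalk (pawalk_verts x p) (with_proj G)"
    using awalk_imp_vwalk[OF a] by simp
  then have "pawalk_verts x p \<in> paths_between G x y"
    using vwalk_arcs_pawalk_verts[OF c] pawalk_verts_ne[OF c] by (simp add: paths_between_def)
  then show "p \<in> vwalk_arcs ` paths_between G x y"
    using vwalk_arcs_pawalk_verts[OF c] by (metis imageI)
qed

lemma path_dist_eq_\<mu>: "path_dist G \<xi> x y = \<mu> \<xi> x y"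
  unfolding path_dist_def \<mu>_def vwalk_arcs_image_paths_between[symmetric]
  by (simp add: image_image path_len_def awalk_cost_def)

lemma path_dist_attained:
  assumes "\<And>e. e \<in> parcs G \<Longrightarrow> 0 \<le> \<xi> e" and "paths_between G x y \<noteq> {}"
  shows "\<exists>\<omega>\<in>paths_between G x y. path_dist G \<xi> x y = ereal (path_len \<xi> \<omega>)"
proof -
  have "\<exists>p. awalk x p y"
    using assms(2) vwalk_arcs_image_paths_between[of x y] by blast
  then have "x \<rightarrow>\<^sup>*\<^bsub>with_proj G\<^esub> y" by (simp add: reachable_awalk)
  then obtain p where p: "awalk x p y" "\<mu> \<xi> x y = awalk_cost \<xi> p"
    using min_cost_awalk assms(1) by (metis awalkI_apath)
  then obtain \<omega> where "\<omega> \<in> paths_between G x y" "p = vwalk_arcs \<omega>"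
    using vwalk_arcs_image_paths_between[of x y] by blast
  with p show ?thesis
    by (auto simp: path_dist_eq_\<mu> path_len_def awalk_cost_def)
qed

end

end

theory Submission
  imports Defs
begin

text \<open>The condition \<open>min (i e) (\<xi> e - Du e) = 0\<close> says that \<open>Du \<le> \<xi>\<close> on every edge, with equality
  where \<open>i > 0\<close>. Summing \<open>Du\<close> along a path telescopes, so \<open>u(\<omega>\<^sup>+) - u(\<omega>\<^sup>-)\<close> is a lower bound for the
  length of every path with the endpoints of \<open>\<omega>\<close>, and it is attained by paths in \<open>{i > 0}\<close>.\<close>

text \<open>Each induction step splits off the first edge, and the value of \<open>u\<close> at the
  shared node cancels. A one-node path gives 0 on both sides; for \<open>[]\<close>,
  \<open>hd\<close> and \<open>last\<close> would be unspecified.\<close>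

lemma path_len_grad:
  "\<omega> \<noteq> [] \<Longrightarrow> path_len (grad u) \<omega> = u (last \<omega>) - u (hd \<omega>)"
  by (induction \<omega> rule: vwalk_arcs.induct) (auto simp: path_len_def grad_def)

lemma path_len_mono:
  "(\<And>e. e \<in> set (vwalk_arcs \<omega>) \<Longrightarrow> f e \<le> g e) \<Longrightarrow> path_len f \<omega> \<le> path_len g \<omega>"
  unfolding path_len_def by (rule sum_list_mono)

lemma path_len_cong:
  "(\<And>e. e \<in> set (vwalk_arcs \<omega>) \<Longrightarrow> f e = g e) \<Longrightarrow> path_len f \<omega> = path_len g \<omega>"
  unfolding path_len_def by (intro arg_cong[where f = sum_list] map_cong refl)

theorem lemma3p12:
  fixes G :: "'a pair_pre_digraph"
    and i \<xi> :: "'a \<times> 'a \<Rightarrow> real"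
    and u :: "'a \<Rightarrow> real"
    and \<omega> :: "'a list"
  assumes "pair_fin_digraph G"
    and "\<forall>e\<in>parcs G. 0 \<le> i e"
    and "\<forall>e\<in>parcs G. 0 \<le> \<xi> e"
    and "\<forall>e\<in>parcs G. min (i e) (\<xi> e - grad u e) = 0"
    and "vwalk \<omega> (with_proj G)"
    and "set (vwalk_arcs \<omega>) \<subseteq> {e \<in> parcs G. i e > 0}"
  shows "\<omega> \<in> Geod G \<xi> \<and>
    path_dist G \<xi> (hd \<omega>) (last \<omega>) = ereal (path_len \<xi> \<omega>) \<and>
    path_len \<xi> \<omega> = u (last \<omega>) - u (hd \<omega>)"
proof -
  have le: "grad u e \<le> \<xi> e" if "e \<in> parcs G" for e
    using assms(4)[rule_format, OF that] by (simp add: min_def split: if_splits)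
  \<comment> \<open>Complementary slackness: as \<open>i e > 0\<close>, the zero minimum must come
    from \<open>\<xi> e - grad u e\<close>.\<close>
  have eq: "\<xi> e = grad u e" if "e \<in> set (vwalk_arcs \<omega>)" for e
  proof -
    have "e \<in> parcs G" "i e > 0"
      using assms(6) that by auto
    then show ?thesis
      using assms(4)[rule_format, of e] by (simp add: min_def split: if_splits)
  qed
  have "\<omega> \<noteq> []"
    using assms(5) by auto
  then have len: "path_len \<xi> \<omega> = u (last \<omega>) - u (hd \<omega>)"
    by (simp add: path_len_cong[OF eq] path_len_grad)
  have lower: "path_len \<xi> \<omega> \<le> path_len \<xi> \<omega>'"
    if "\<omega>' \<in> paths_between G (hd \<omega>) (last \<omega>)" for \<omega>'
  proof -
    have \<omega>': "vwalk \<omega>' (with_proj G)" "hd \<omega>' = hd \<omega>" "last \<omega>' = last \<omega>"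
      using that by (auto simp: paths_between_def)
    then have "\<omega>' \<noteq> []" "set (vwalk_arcs \<omega>') \<subseteq> parcs G"
      by (auto simp: vwalk_def)
    \<comment> \<open>A competitor may leave the set where \<open>i > 0\<close>, so only the
      inequality \<open>le\<close> is available on its edges.\<close>
    then have "path_len (grad u) \<omega>' \<le> path_len \<xi> \<omega>'"
      by (intro path_len_mono le) auto
    then show ?thesis
      using len \<omega>' path_len_grad[OF \<open>\<omega>' \<noteq> []\<close>] by simp
  qed
  have "\<omega> \<in> paths_between G (hd \<omega>) (last \<omega>)"
    using assms(5) by (simp add: paths_between_def)
  \<comment> \<open>\<open>\<omega>\<close> is itself a competitor, which bounds the infimum above;
    \<open>lower\<close> bounds it below.\<close>
  then have "path_dist G \<xi> (hd \<omega>) (last \<omega>) = ereal (path_len \<xi> \<omega>)"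
    unfolding path_dist_def by (intro antisym INF_lower INF_greatest) (simp_all add: lower)
  then show ?thesis
    using len assms(5) by (simp add: Geod_def)
qed

end
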